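(* Let $(\mathcal{C},\lambda)$ be a $(2n+1)$-dimensional contact manifold with canonical coordinates $(x,p,z)$, $x=\{x^1,\dots,x^n\}$, $p=\{p_1,\dots,p_n\}$, $\lambda=dz-p_a\,dx^a$. Let $\varphi$ be a strictly convex function of $p$ only such that the Legendre submanifold $\mathcal{A}_\varphi$ generated by $-\varphi$ is simply connected, and let $\Phi:\mathcal{A}_\varphi\to\mathcal{C}$, $p\mapsto(x(p),p,z(p))$ with $x^a(p)=\partial\varphi/\partial p_a$, $z(p)=p_i\,\partial\varphi/\partial p_i-\varphi(p)$, be the embedding with image $\mathcal{A}_\varphi^{\mathcal{C}}$. Let $\{F_1,\dots,F_n\}$ be a set of functions of $p$ on $\mathcal{A}_\varphi$ such that they do not identically vanish, and let $\check X=\dot p_a\,\partial/\partial p_a$ with $\dot p_a=F_a(p)$ be the associated vector field on $\mathcal{A}_\varphi$. Let $X^0:=\Phi_*\check X$ be its push-forward, a vector field on $\mathcal{A}_\varphi^{\mathcal{C}}$. Then $$X^0=\dot x^a\frac{\partial}{\partial x^a}+\dot p_a\frac{\partial}{\partial p_a}+\dot z\frac{\partial}{\partial z},\qquad \dot x^a=\frac{d}{dt}\Big(\frac{\partial\varphi}{\partial p_a}\Big),\quad \dot p_a=F_a(p),\quad \dot z=p_jF_k\frac{\partial^2\varphi}{\partial p_k\partial p_j}.$$ In addition, $$X^0=X_h\big|_{h=0},$$ where $X_h$ is the contact Hamiltonian vector field on $\mathcal{C}$ associated to $$h=\Delta^a(x,p)\,F_a(p)+\Gamma(\Delta^0),$$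 $\Gamma$ being a function of $\Delta^0$ such that $\Gamma(0)=0$ and $\Gamma(\Delta^0)\neq0$ for $\Delta^0\neq0$, and $X_h|_{h=0}$ denotes the restriction of $X_h$ to $h=0$.
   Context: All objects are smooth, repeated indices are summed over $1,\dots,n$, and everything is expressed in the canonical coordinates $(x,p,z)$. The dot and $d/dt$ denote differentiation with respect to a parameter $t$, i.e. along $\dot p_a=F_a(p)$. Put $$\Delta^0(x,p,z)=x^jp_j-\varphi(p)-z,\qquad \Delta^a(x,p)=x^a-\frac{\partial\varphi}{\partial p_a}(p).$$ The Legendre submanifold $\mathcal{A}_\varphi$ generated by $-\varphi$ is parametrized by $p$ and its embedded image is $$\mathcal{A}_\varphi^{\mathcal{C}}=\{(x,p,z):\Delta^0=0\ \text{and}\ \Delta^1=\dots=\Delta^n=0\}=\Big\{x^a=\frac{\partial\varphi}{\partial p_a},\ z=p_i\frac{\partial\varphi}{\partial p_i}-\varphi(p)\Big\}.$$ For a function $h$ on $\mathcal{C}$, the contact Hamiltonian vector field $X_h$ is defined by $\iota_{X_h}\lambda=h$ and $\iota_{X_h}d\lambda=-(dh-(\mathcal{R}h)\lambda)$, where $\mathcal{R}=\partial/\partial z$ is the Reeb vector field; in coordinates $$\dot x^a=-\frac{\partial h}{\partial p_a},\qquad \dot p_a=\frac{\partial h}{\partial x^a}+p_a\frac{\partial h}{\partial z},\qquad \dot z=h-p_a\frac{\partial h}{\partial p_a}.$$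
   Formalization: The equality X^0 = X_h|_{h=0} is stated at the points of A_φ^C, which is shown to lie in {h=0}; equality on all of {h=0} is impossible, since {h=0} is strictly larger than A_φ^C. *)

theory Defs
  imports "HOL-Analysis.Analysis"
begin

text \<open>Intended for open \<open>S\<close>, where derivatives do not depend on values outside \<open>S\<close>.\<close>

fun C_k_on :: "nat \<Rightarrow> 'a::real_normed_vector set \<Rightarrow> ('a \<Rightarrow> 'b::real_normed_vector) \<Rightarrow> bool" where
  "C_k_on 0 S f \<longleftrightarrow> continuous_on S f"
| "C_k_on (Suc k) S f \<longleftrightarrow>
     (\<forall>x\<in>S. f differentiable (at x)) \<and>
     (\<forall>v. C_k_on k S (\<lambda>x. frechet_derivative f (at x) v))"

definition smooth_on :: "'a::real_normed_vector set \<Rightarrow> ('a \<Rightarrow> 'b::real_normed_vector) \<Rightarrow> bool" where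
  "smooth_on S f \<longleftrightarrow> (\<forall>k. C_k_on k S f)"

text \<open>The set \<open>S\<close> is not required to be convex; the inequality is imposed along every segment
  contained in \<open>S\<close>. For convex \<open>S\<close> this is the usual strict convexity.\<close>

definition strictly_convex_on :: "'a::real_vector set \<Rightarrow> ('a \<Rightarrow> real) \<Rightarrow> bool" where
  "strictly_convex_on S f \<longleftrightarrow>
     (\<forall>x\<in>S. \<forall>y\<in>S. \<forall>u>0. \<forall>v>0. x \<noteq> y \<longrightarrow> closed_segment x y \<subseteq> S \<longrightarrow> u + v = 1 \<longrightarrow>
        f (u *\<^sub>R x + v *\<^sub>R y) < u * f x + v * f y)"

definition partial :: "'n::finite \<Rightarrow> (real^'n \<Rightarrow> real) \<Rightarrow> real^'n \<Rightarrow> real" where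
  "partial a f p = frechet_derivative f (at p) (axis a 1)"

text \<open>This is \<open>dg/dt\<close> along solutions of \<open>dp/dt = X(p)\<close>.\<close>

definition along :: "('a \<Rightarrow> 'a) \<Rightarrow> ('a::real_normed_vector \<Rightarrow> real) \<Rightarrow> 'a \<Rightarrow> real" where
  "along X g p = frechet_derivative g (at p) (X p)"

text \<open>For \<open>f\<close> injective on \<open>S\<close> this is the push-forward of the vector field \<open>X\<close> on \<open>S\<close>.
  It is a vector field along \<open>f ` S\<close>; its values elsewhere are meaningless.\<close>

definition pushforward ::
    "('a::real_normed_vector \<Rightarrow> 'b::real_normed_vector) \<Rightarrow> 'a set \<Rightarrow> ('a \<Rightarrow> 'a) \<Rightarrow> 'b \<Rightarrow> 'b" where
  "pushforward f S X q = (let p = inv_into S f q in frechet_derivative f (at p) (X p))"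

text \<open>A 1-form is given as \<open>\<omega> \<xi> v\<close> (point, tangent vector), and
  \<open>(\<alpha> \<and> \<beta>)(u, v) = \<alpha>(u) \<beta>(v) - \<alpha>(v) \<beta>(u)\<close>. The formula is
  \<open>d\<omega>(U, V) = U(\<omega>(V)) - V(\<omega>(U)) - \<omega>([U, V])\<close> for constant fields \<open>U\<close>, \<open>V\<close>.\<close>

definition ext_deriv :: "('a::real_normed_vector \<Rightarrow> 'a \<Rightarrow> real) \<Rightarrow> 'a \<Rightarrow> 'a \<Rightarrow> 'a \<Rightarrow> real" where
  "ext_deriv \<omega> \<xi> u v =
     frechet_derivative (\<lambda>\<eta>. \<omega> \<eta> v) (at \<xi>) u - frechet_derivative (\<lambda>\<eta>. \<omega> \<eta> u) (at \<xi>) v"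


text \<open>Points \<open>(x, p, z)\<close>. As every tangent space is identified with the coordinate space,
  \<open>(a, b, c)\<close> also stands for the tangent vector
  \<open>a\<^sup>i \<partial>/\<partial>x\<^sup>i + b\<^sub>i \<partial>/\<partial>p\<^sub>i + c \<partial>/\<partial>z\<close>. A contact manifold
  with canonical coordinates is an open set of such points with the form below.\<close>

type_synonym 'n coords = "(real^'n) \<times> (real^'n) \<times> real"

definition contact_form :: "'n::finite coords \<Rightarrow> 'n coords \<Rightarrow> real" where
  "contact_form = (\<lambda>(x, p, z) (vx, vp, vz). vz - (\<Sum>a\<in>UNIV. p $ a * vx $ a))"

definition reeb :: "'n::finite coords" where
  "reeb = (0, 0, 1)"

text \<open>The conditions are \<open>\<iota>\<^sub>X \<lambda> = h\<close> and
  \<open>\<iota>\<^sub>X d\<lambda> = - (dh - (R h) \<lambda>)\<close>. Where \<open>h\<close> is differentiable they have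
  exactly one solution, because \<open>\<lambda>\<close> is a contact form.\<close>

definition contact_ham_field ::
    "('n::finite coords \<Rightarrow> real) \<Rightarrow> 'n coords \<Rightarrow> 'n coords" where
  "contact_ham_field h \<xi> = (THE X.
     contact_form \<xi> X = h \<xi> \<and>
     (\<forall>v. ext_deriv contact_form \<xi> X v =
        - (frechet_derivative h (at \<xi>) v
           - frechet_derivative h (at \<xi>) reeb * contact_form \<xi> v)))"

definition Delta0 :: "(real^'n::finite \<Rightarrow> real) \<Rightarrow> 'n coords \<Rightarrow> real" where
  "Delta0 \<phi> = (\<lambda>(x, p, z). (\<Sum>j\<in>UNIV. x $ j * p $ j) - \<phi> p - z)"

definition Delta :: "(real^'n::finite \<Rightarrow> real) \<Rightarrow> 'n \<Rightarrow> 'n coords \<Rightarrow> real" where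
  "Delta \<phi> a = (\<lambda>(x, p, z). x $ a - partial a \<phi> p)"

definition legendre_image ::
    "'n::finite coords set \<Rightarrow> (real^'n \<Rightarrow> real) \<Rightarrow> 'n coords set" where
  "legendre_image C \<phi> = {\<xi>\<in>C. Delta0 \<phi> \<xi> = 0 \<and> (\<forall>a. Delta \<phi> a \<xi> = 0)}"

definition legendre_embedding :: "(real^'n::finite \<Rightarrow> real) \<Rightarrow> real^'n \<Rightarrow> 'n coords" where
  "legendre_embedding \<phi> p =
     ((\<chi> a. partial a \<phi> p), p, (\<Sum>i\<in>UNIV. p $ i * partial i \<phi> p) - \<phi> p)"

definition hamiltonian ::
    "(real^'n::finite \<Rightarrow> real) \<Rightarrow> (real^'n \<Rightarrow> real^'n) \<Rightarrow> (real \<Rightarrow> real) \<Rightarrow> 'n coords \<Rightarrow> real" where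
  "hamiltonian \<phi> F \<Gamma> = (\<lambda>(x, p, z).
     (\<Sum>a\<in>UNIV. Delta \<phi> a (x, p, z) * F p $ a) + \<Gamma> (Delta0 \<phi> (x, p, z)))"

end

theory Submission
  imports Defs
begin

text \<open>The \<open>x\<close>-components of the two fields are transposes of each other: they are
  \<open>F\<^sub>k \<partial>\<^sub>k \<partial>\<^sub>a \<phi>\<close> for the push-forward and \<open>F\<^sub>k \<partial>\<^sub>a \<partial>\<^sub>k \<phi>\<close> for
  the contact Hamiltonian field, so they agree by the symmetry of the Hessian. In the
  \<open>p\<close>-components the contributions \<open>\<Gamma>'(0) p\<^sub>a\<close> of \<open>\<partial>h/\<partial>x\<^sup>a\<close> and of
  \<open>p\<^sub>a \<partial>h/\<partial>z\<close> cancel. In \<open>\<partial>h/\<partial>p\<^sub>a\<close> the function \<open>\<Gamma>\<close> and the derivatives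
  of \<open>F\<close> only occur multiplied by some \<open>\<Delta>\<^sup>b = 0\<close>.\<close>

section \<open>Symmetry of second derivatives\<close>

text \<open>The mean value theorem in the direction \<open>u\<close> turns the second difference
  into \<open>h\<close> times a difference of two values of the first derivative along
  \<open>u\<close>. Expanding both values at \<open>p\<close> to first order leaves
  \<open>h * G' v\<close> up to o(h).\<close>

lemma second_difference_quotient_tendsto:
  fixes f :: "'a::real_normed_vector \<Rightarrow> real"
  assumes "open S" "p \<in> S"
    and diff: "\<And>x. x \<in> S \<Longrightarrow> f differentiable (at x)"
    and G': "((\<lambda>x. frechet_derivative f (at x) u) has_derivative G') (at p)"
  shows "((\<lambda>h. (f (p + h *\<^sub>R u + h *\<^sub>R v) - f (p + h *\<^sub>R u) - f (p + h *\<^sub>R v) + f p) / h\<^sup>2)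
    \<longlongrightarrow> G' v) (at_right 0)"
proof (rule tendstoI)
  fix e :: real assume "e > 0"
  define G where "G x = frechet_derivative f (at x) u" for x
  define K where "K = norm u + norm v + 1"
  have K: "K > 0" unfolding K_def by (simp add: add_nonneg_pos)
  have lin: "linear G'"
    using G' by (rule has_derivative_linear)
  obtain d1 where d1: "d1 > 0" "ball p d1 \<subseteq> S"
    using assms(1,2) by (meson openE)
  \<comment> \<open>Two expansions are subtracted below; with this constant each costs at most
    \<open>e / 4 * h\<close>, so their sum stays below \<open>e * h\<close>.\<close>
  have "e / (4 * K) > 0" using \<open>e > 0\<close> K by simp
  then obtain d2 where d2: "d2 > 0"
    "\<And>y. norm (y - p) < d2 \<Longrightarrow> norm (G y - G p - G' (y - p)) \<le> e / (4 * K) * norm (y - p)"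
    using G' unfolding has_derivative_at_alt G_def by blast
  \<comment> \<open>All points used lie within \<open>h * K\<close> of \<open>p\<close>, so
    \<open>h < d\<close> keeps them both in \<open>S\<close> and in the range of the linear
    approximation of \<open>G\<close>. The summand 1 in \<open>K\<close> makes it positive even for
    \<open>u = v = 0\<close>.\<close>
  define d where "d = min d1 d2 / K"
  have "d > 0" using d1 d2 K by (simp add: d_def)
  have "\<bar>(f (p + h *\<^sub>R u + h *\<^sub>R v) - f (p + h *\<^sub>R u) - f (p + h *\<^sub>R v) + f p) / h\<^sup>2 - G' v\<bar> < e"
    if h: "0 < h" "h < d" for h
  proof -
    have hK: "h * K < d1" "h * K < d2"
      using h K by (auto simp: d_def pos_less_divide_eq)
    have small: "norm (s *\<^sub>R u + r *\<^sub>R v) \<le> h * K"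
      if "0 \<le> s" "s \<le> h" "0 \<le> r" "r \<le> h" for s r
    proof -
      have "norm (s *\<^sub>R u + r *\<^sub>R v) \<le> s * norm u + r * norm v"
        using norm_triangle_ineq[of "s *\<^sub>R u" "r *\<^sub>R v"] that by simp
      also have "\<dots> \<le> h * norm u + h * norm v"
        using that by (intro add_mono mult_right_mono) auto
      also have "\<dots> \<le> h * K" using h by (simp add: K_def algebra_simps)
      finally show ?thesis .
    qed
    have inS: "p + s *\<^sub>R u + r *\<^sub>R v \<in> S"
      if "0 \<le> s" "s \<le> h" "0 \<le> r" "r \<le> h" for s r
    proof -
      have "p + s *\<^sub>R u + r *\<^sub>R v \<in> ball p d1"
        using small[OF that] hK norm_minus_cancel[of "s *\<^sub>R u + r *\<^sub>R v"]
        by (simp add: dist_norm)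
      then show ?thesis using d1 by blast
    qed
    have der: "((\<lambda>s. f (p + s *\<^sub>R u + r *\<^sub>R v)) has_real_derivative G (p + s *\<^sub>R u + r *\<^sub>R v)) (at s)"
      if "0 \<le> s" "s \<le> h" "0 \<le> r" "r \<le> h" for s r
    proof -
      have D: "(f has_derivative frechet_derivative f (at (p + s *\<^sub>R u + r *\<^sub>R v)))
          (at (p + s *\<^sub>R u + r *\<^sub>R v))"
        using diff[OF inS[OF that]] frechet_derivative_works by blast
      have "((\<lambda>s. p + s *\<^sub>R u + r *\<^sub>R v) has_derivative (\<lambda>t. t *\<^sub>R u)) (at s)"
        by (auto intro!: derivative_eq_intros)
      from has_derivative_compose[OF this D]
      have "((\<lambda>s. f (p + s *\<^sub>R u + r *\<^sub>R v)) has_derivative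
          (\<lambda>t. frechet_derivative f (at (p + s *\<^sub>R u + r *\<^sub>R v)) (t *\<^sub>R u))) (at s)" .
      then show ?thesis
        unfolding has_field_derivative_def G_def
        by (rule has_derivative_eq_rhs)
          (simp add: linear_scale[OF has_derivative_linear[OF D]] fun_eq_iff)
    qed
    \<comment> \<open>Mean value theorem for \<open>f (p + s *\<^sub>R u + h *\<^sub>R v) - f (p + s
      *\<^sub>R u)\<close> as a function of \<open>s\<close>; the zero multiples are kept so that
      \<open>der\<close> matches with \<open>r = 0\<close>.\<close>
    have "\<exists>s>0. s < h \<and>
        (f (p + h *\<^sub>R u + h *\<^sub>R v) - f (p + h *\<^sub>R u + 0 *\<^sub>R v))
         - (f (p + 0 *\<^sub>R u + h *\<^sub>R v) - f (p + 0 *\<^sub>R u + 0 *\<^sub>R v))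
        = (h - 0) * (G (p + s *\<^sub>R u + h *\<^sub>R v) - G (p + s *\<^sub>R u + 0 *\<^sub>R v))"
      using h by (intro MVT2 DERIV_diff der) auto
    then obtain s where s: "0 < s" "s < h" and
      eq: "f (p + h *\<^sub>R u + h *\<^sub>R v) - f (p + h *\<^sub>R u) - f (p + h *\<^sub>R v) + f p
        = h * (G (p + s *\<^sub>R u + h *\<^sub>R v) - G (p + s *\<^sub>R u + 0 *\<^sub>R v))"
      by auto
    have bound: "\<bar>G (p + s *\<^sub>R u + r *\<^sub>R v) - G p - (s * G' u + r * G' v)\<bar> \<le> e / 4 * h"
      if "0 \<le> r" "r \<le> h" for r
    proof -
      have sm: "norm (s *\<^sub>R u + r *\<^sub>R v) \<le> h * K" using s that by (intro small) auto
      have "\<bar>G (p + (s *\<^sub>R u + r *\<^sub>R v)) - G p - G' (s *\<^sub>R u + r *\<^sub>R v)\<bar>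
          \<le> e / (4 * K) * norm (s *\<^sub>R u + r *\<^sub>R v)"
        using d2(2)[of "p + (s *\<^sub>R u + r *\<^sub>R v)"] sm hK by simp
      also have "\<dots> \<le> e / (4 * K) * (h * K)"
        using sm \<open>e / (4 * K) > 0\<close> by (intro mult_left_mono) auto
      also have "\<dots> = e / 4 * h" using K by simp
      finally show ?thesis
        by (simp add: linear_add[OF lin] linear_scale[OF lin] add.assoc)
    qed
    \<comment> \<open>The unknown term \<open>s * G' u\<close> is the same in \<open>bound\<close>
      for \<open>r = h\<close> and for \<open>r = 0\<close>, so it cancels.\<close>
    have "\<bar>G (p + s *\<^sub>R u + h *\<^sub>R v) - G (p + s *\<^sub>R u + 0 *\<^sub>R v) - h * G' v\<bar> \<le> e / 2 * h"
      using bound[of h] bound[of 0] h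
      unfolding abs_le_iff mult_zero_left scaleR_zero_left add_0_right by linarith
    also have "\<dots> < e * h" using h \<open>e > 0\<close> by simp
    finally have "\<bar>(G (p + s *\<^sub>R u + h *\<^sub>R v) - G (p + s *\<^sub>R u + 0 *\<^sub>R v) - h * G' v) / h\<bar> < e"
      using h by (simp add: abs_divide pos_divide_less_eq)
    then show ?thesis
      using h unfolding eq by (simp add: power2_eq_square diff_divide_distrib)
  qed
  then show "\<forall>\<^sub>F h in at_right 0. dist ((f (p + h *\<^sub>R u + h *\<^sub>R v) - f (p + h *\<^sub>R u)
      - f (p + h *\<^sub>R v) + f p) / h\<^sup>2) (G' v) < e"
    using \<open>d > 0\<close> by (auto simp: eventually_at_right_field dist_real_def)
qed

text \<open>The second difference does not change when \<open>u\<close> and \<open>v\<close> are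
  exchanged, so both iterated derivatives are limits of one and the same quotient.\<close>

lemma second_derivative_symmetric:
  fixes f :: "'a::real_normed_vector \<Rightarrow> real"
  assumes "open S" "p \<in> S"
    and "\<And>x. x \<in> S \<Longrightarrow> f differentiable (at x)"
    and "\<And>w. (\<lambda>x. frechet_derivative f (at x) w) differentiable (at p)"
  shows "frechet_derivative (\<lambda>x. frechet_derivative f (at x) u) (at p) v =
    frechet_derivative (\<lambda>x. frechet_derivative f (at x) v) (at p) u"
proof -
  note lim = second_difference_quotient_tendsto[OF assms(1-3)
      assms(4)[unfolded frechet_derivative_works]]
  have swap: "(\<lambda>h. (f (p + h *\<^sub>R v + h *\<^sub>R u) - f (p + h *\<^sub>R v) - f (p + h *\<^sub>R u) + f p) / h\<^sup>2) =
    (\<lambda>h. (f (p + h *\<^sub>R u + h *\<^sub>R v) - f (p + h *\<^sub>R u) - f (p + h *\<^sub>R v) + f p) / h\<^sup>2)"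
    by (simp add: algebra_simps)
  show ?thesis
    by (rule tendsto_unique[OF trivial_limit_at_right_real lim[of u v] lim[of v u, unfolded swap]])
qed

section \<open>Componentwise derivatives, smoothness and partial derivatives\<close>

lemma has_derivative_vec_nth [derivative_intros]:
  "(f has_derivative f') F \<Longrightarrow> ((\<lambda>x. f x $ i) has_derivative (\<lambda>v. f' v $ i)) F"
  by (rule bounded_linear.has_derivative[OF bounded_linear_vec_nth])

lemma has_derivative_vec_lambda:
  fixes f :: "'n::finite \<Rightarrow> 'a::real_normed_vector \<Rightarrow> real"
  assumes "\<And>i. (f i has_derivative f' i) (at x)"
  shows "((\<lambda>x. \<chi> i. f i x) has_derivative (\<lambda>v. \<chi> i. f' i v)) (at x)"
  using assms
  by (subst has_derivative_componentwise_within)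
    (auto simp: Basis_vec_def inner_axis)

lemma linear_eq_sum_axis:
  fixes L :: "real^'n::finite \<Rightarrow> 'a::real_vector"
  assumes "linear L"
  shows "L v = (\<Sum>k\<in>UNIV. v $ k *\<^sub>R L (axis k 1))"
proof -
  have "L v = L (\<Sum>k\<in>UNIV. v $ k *\<^sub>R axis k 1)"
    by (simp add: basis_expansion flip: scalar_mult_eq_scaleR)
  then show ?thesis
    by (simp add: linear_sum[OF assms] linear_scale[OF assms])
qed

lemma smooth_on_differentiable:
  assumes "smooth_on S f" "x \<in> S"
  shows "f differentiable (at x)"
proof -
  have "C_k_on (Suc 0) S f" using assms(1) unfolding smooth_on_def by blast
  then show ?thesis using assms(2) by simp
qed

lemma smooth_on_frechet_derivative:
  assumes "smooth_on S f"
  shows "smooth_on S (\<lambda>x. frechet_derivative f (at x) v)"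
  unfolding smooth_on_def
proof
  fix k
  have "C_k_on (Suc k) S f" using assms unfolding smooth_on_def by blast
  then show "C_k_on k S (\<lambda>x. frechet_derivative f (at x) v)" by simp
qed

lemma smooth_on_partial: "smooth_on S f \<Longrightarrow> smooth_on S (partial a f)"
  unfolding partial_def by (rule smooth_on_frechet_derivative)

lemma has_derivative_partial_sum:
  assumes "f differentiable (at p)"
  shows "(f has_derivative (\<lambda>v. \<Sum>k\<in>UNIV. v $ k * partial k f p)) (at p)"
proof -
  have D: "(f has_derivative frechet_derivative f (at p)) (at p)"
    using assms frechet_derivative_works by blast
  then show ?thesis
    unfolding partial_def
    by (rule has_derivative_eq_rhs)
      (simp flip: linear_eq_sum_axis[OF has_derivative_linear[OF D], unfolded real_scaleR_def])
qed

lemma along_eq_sum: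
  assumes "f differentiable (at p)"
  shows "along X f p = (\<Sum>k\<in>UNIV. X p $ k * partial k f p)"
  unfolding along_def
  by (simp add: frechet_derivative_at[OF has_derivative_partial_sum[OF assms], symmetric])

lemma partial_commute:
  assumes "open S" "p \<in> S" "smooth_on S f"
  shows "partial a (partial b f) p = partial b (partial a f) p"
  unfolding partial_def
  using assms(1,2) smooth_on_differentiable[OF assms(3)]
    smooth_on_differentiable[OF smooth_on_frechet_derivative[OF assms(3)] assms(2)]
  by (rule second_derivative_symmetric)

section \<open>The contact form and its Hamiltonian fields in coordinates\<close>

text \<open>This is d\<lambda> = dx^a \<and> dp_a: on a constant vector, \<lambda> depends on the
  point only through \<open>p\<close>, and affinely.\<close>

lemma ext_deriv_contact_form:
  "ext_deriv contact_form \<xi> (ux, up, uz) (vx, vp, vz) = ux \<bullet> vp - up \<bullet> vx"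
proof -
  have D: "((\<lambda>\<eta>. contact_form \<eta> (wx, wp, wz)) has_derivative (\<lambda>\<delta>. - (fst (snd \<delta>) \<bullet> wx))) (at \<xi>)"
    for wx wp :: "real^'a" and wz :: real
    unfolding contact_form_def case_prod_unfold inner_vec_def inner_real_def
    by (auto intro!: derivative_eq_intros)
  show ?thesis
    unfolding ext_deriv_def by (simp add: frechet_derivative_at[OF D, symmetric] inner_commute)
qed

text \<open>Replaces the definite description by the classical coordinate formulas. The condition on
  d\<lambda> pins down the x- and p-components, since the inner product is nondegenerate; the
  condition on \<lambda> then pins down the z-component.\<close>

lemma contact_ham_field_eq:
  assumes D: "(h has_derivative Dh) (at (x, p, z))"
  shows "contact_ham_field h (x, p, z) =
    (- (\<chi> a. Dh (0, axis a 1, 0)),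
     (\<chi> a. Dh (axis a 1, 0, 0) + p $ a * Dh (0, 0, 1)),
     h (x, p, z) - (\<Sum>a\<in>UNIV. p $ a * Dh (0, axis a 1, 0)))"
    (is "_ = (?X, ?P, ?Z)")
proof -
  have lin: "linear Dh" using D by (rule has_derivative_linear)
  have lx: "linear (\<lambda>v. Dh (v, 0, 0))" and lp: "linear (\<lambda>v. Dh (0, v, 0))"
    by (auto intro!: linearI simp flip: linear_add[OF lin] linear_scale[OF lin, unfolded real_scaleR_def])
  have split: "Dh (vx, vp, vz) = (\<Sum>a\<in>UNIV. vx $ a * Dh (axis a 1, 0, 0))
      + (\<Sum>a\<in>UNIV. vp $ a * Dh (0, axis a 1, 0)) + vz * Dh (0, 0, 1)" for vx vp vz
  proof -
    have "Dh (vx, vp, vz) = Dh ((vx, 0, 0) + (0, vp, 0) + vz *\<^sub>R (0, 0, 1))" by simp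
    also have "\<dots> = Dh (vx, 0, 0) + Dh (0, vp, 0) + vz * Dh (0, 0, 1)"
      by (simp only: linear_add[OF lin] linear_scale[OF lin] real_scaleR_def)
    finally show ?thesis
      using linear_eq_sum_axis[OF lx, of vx] linear_eq_sum_axis[OF lp, of vp] by simp
  qed
  \<comment> \<open>Subtracting the Reeb term removes \<open>vz\<close>, so the right-hand side
    takes the form of \<open>ext_deriv_contact_form\<close> and the components can be
    compared.\<close>
  have rhs: "- (Dh (vx, vp, vz) - Dh reeb * contact_form (x, p, z) (vx, vp, vz))
      = ?X \<bullet> vp - ?P \<bullet> vx" for vx vp vz
    unfolding split[of vx vp vz] reeb_def contact_form_def inner_vec_def
    by (simp add: algebra_simps sum.distrib sum_distrib_left sum_negf)
  show ?thesis
    unfolding contact_ham_field_def frechet_derivative_at[OF D, symmetric]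
  proof (rule the_equality)
    show "contact_form (x, p, z) (?X, ?P, ?Z) = h (x, p, z) \<and>
      (\<forall>v. ext_deriv contact_form (x, p, z) (?X, ?P, ?Z) v =
        - (Dh v - Dh reeb * contact_form (x, p, z) v))"
      unfolding split_paired_all rhs ext_deriv_contact_form
      by (auto simp only: split_paired_All rhs ext_deriv_contact_form)
        (simp add: contact_form_def sum_negf)
  next
    fix Y
    assume Y: "contact_form (x, p, z) Y = h (x, p, z) \<and>
      (\<forall>v. ext_deriv contact_form (x, p, z) Y v =
        - (Dh v - Dh reeb * contact_form (x, p, z) v))"
    obtain yx yp yz where Y_eq: "Y = (yx, yp, yz)" by (cases Y)
    \<comment> \<open>Neither side depends on the z-component of the test vector, so 0 is taken for
      it; setting \<open>vx = 0\<close> or \<open>vp = 0\<close> afterwards isolates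
      \<open>yx\<close> or \<open>yp\<close>.\<close>
    have eq: "yx \<bullet> vp - yp \<bullet> vx = ?X \<bullet> vp - ?P \<bullet> vx" for vx vp
      using Y[THEN conjunct2, rule_format, of "(vx, vp, 0)"]
      unfolding Y_eq ext_deriv_contact_form rhs .
    have "\<forall>v. yx \<bullet> v = ?X \<bullet> v"
      using eq[where vx = 0] by simp
    then have "yx = ?X" by (simp only: vector_eq_rdot)
    have "\<forall>v. yp \<bullet> v = ?P \<bullet> v"
      using eq[where vp = 0] by simp
    then have "yp = ?P" by (simp only: vector_eq_rdot)
    have "yz = ?Z"
      using Y \<open>yx = ?X\<close> unfolding Y_eq by (simp add: contact_form_def sum_negf)
    show "Y = (?X, ?P, ?Z)" unfolding Y_eq \<open>yx = ?X\<close> \<open>yp = ?P\<close> \<open>yz = ?Z\<close> ..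
  qed
qed

section \<open>Differentials of the embedding and of the Hamiltonian\<close>

text \<open>In the z-component the product rule yields \<open>v $ i * partial i \<phi> p\<close>,
  whose sum cancels against the differential of \<open>\<phi>\<close>; only the Hessian term
  survives.\<close>

lemma legendre_embedding_has_derivative:
  assumes "\<phi> differentiable (at p)" "\<And>a. partial a \<phi> differentiable (at p)"
  shows "(legendre_embedding \<phi> has_derivative (\<lambda>v.
    ((\<chi> a. \<Sum>k\<in>UNIV. v $ k * partial k (partial a \<phi>) p), v,
     (\<Sum>j\<in>UNIV. \<Sum>k\<in>UNIV. p $ j * v $ k * partial k (partial j \<phi>) p)))) (at p)"
proof -
  note D1 = has_derivative_partial_sum[OF assms(1)]
    and D2 = has_derivative_partial_sum[OF assms(2)]
  have D: "((\<lambda>p. (\<Sum>i\<in>UNIV. p $ i * partial i \<phi> p) - \<phi> p) has_derivative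
      (\<lambda>v. \<Sum>j\<in>UNIV. \<Sum>k\<in>UNIV. p $ j * v $ k * partial k (partial j \<phi>) p)) (at p)"
    by (rule has_derivative_eq_rhs[OF has_derivative_diff[OF has_derivative_sum[OF
          has_derivative_mult[OF has_derivative_vec_nth[OF has_derivative_ident] D2]] D1]])
      (simp add: fun_eq_iff sum.distrib sum_distrib_left mult.assoc)
  show ?thesis
    unfolding legendre_embedding_def
    by (intro has_derivative_Pair has_derivative_ident D has_derivative_vec_lambda D2)
qed

text \<open>Here \<open>c\<close> is the derivative of \<open>\<Gamma>\<close> at 0. Since
  d\<Delta>^0 = \<Delta>^a dp_a - \<lambda>, the differential of \<Delta>^0 is -\<lambda> at such a
  point, and the product rule leaves only F_a d\<Delta>^a from the first summand.\<close>

lemma hamiltonian_has_derivative: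
  fixes \<phi> :: "real^'n::finite \<Rightarrow> real"
  assumes \<phi>: "\<phi> differentiable (at p)" and \<phi>': "\<And>a. partial a \<phi> differentiable (at p)"
    and "F differentiable (at p)" and "\<Gamma> differentiable (at 0)"
    and Delta0: "Delta0 \<phi> (x, p, z) = 0" and Delta: "\<And>a. Delta \<phi> a (x, p, z) = 0"
  obtains c where "(hamiltonian \<phi> F \<Gamma> has_derivative (\<lambda>(vx, vp, vz).
    (\<Sum>a\<in>UNIV. (vx $ a - (\<Sum>k\<in>UNIV. vp $ k * partial k (partial a \<phi>) p)) * F p $ a)
      + c * ((\<Sum>j\<in>UNIV. vx $ j * p $ j) - vz))) (at (x, p, z))"
proof -
  let ?\<xi> = "(x, p, z)"
  obtain F' where F': "(F has_derivative F') (at p)" using assms(3) unfolding differentiable_def by blast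
  obtain c where c: "(\<Gamma> has_real_derivative c) (at 0)"
    using assms(4) real_differentiable_def by blast
  have snd: "((\<lambda>\<xi>. fst (snd \<xi>)) has_derivative (\<lambda>v. fst (snd v))) (at ?\<xi>)"
    by (auto intro!: derivative_eq_intros)
  have comp: "((\<lambda>\<xi>. g (fst (snd \<xi>))) has_derivative (\<lambda>v. g' (fst (snd v)))) (at ?\<xi>)"
    if "(g has_derivative g') (at p)" for g g'
    using has_derivative_compose[OF snd, of g g'] that by simp
  note D\<phi> = comp[OF has_derivative_partial_sum[OF \<phi>]]
  note D\<phi>' = comp[OF has_derivative_partial_sum[OF \<phi>']]
  \<comment> \<open>Used in \<open>D0\<close> to cancel x^a dp_a against d\<phi>, and in
    \<open>DDelta\<close> to remove the terms with \<open>F'\<close>.\<close>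
  have xa: "x $ a = partial a \<phi> p" for a using Delta[of a] by (simp add: Delta_def)
  have D0: "(Delta0 \<phi> has_derivative (\<lambda>v. (\<Sum>j\<in>UNIV. fst v $ j * p $ j) - snd (snd v))) (at ?\<xi>)"
    unfolding Delta0_def case_prod_unfold
    by (rule derivative_eq_intros D\<phi> refl | simp)+
      (simp add: fun_eq_iff xa sum.distrib mult.commute)
  have DDelta: "((\<lambda>\<xi>. \<Sum>a\<in>UNIV. (fst \<xi> $ a - partial a \<phi> (fst (snd \<xi>))) * F (fst (snd \<xi>)) $ a) has_derivative
      (\<lambda>v. \<Sum>a\<in>UNIV. (fst v $ a - (\<Sum>k\<in>UNIV. fst (snd v) $ k * partial k (partial a \<phi>) p)) * F p $ a)) (at ?\<xi>)"
    by (rule derivative_eq_intros D\<phi>' comp[OF F'] refl | simp)+ (simp add: fun_eq_iff xa)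
  have "((\<lambda>\<xi>. \<Gamma> (Delta0 \<phi> \<xi>)) has_derivative
      (\<lambda>v. c * ((\<Sum>j\<in>UNIV. fst v $ j * p $ j) - snd (snd v)))) (at ?\<xi>)"
    using has_derivative_compose[OF D0, of \<Gamma> "(*) c"] c Delta0
    by (simp add: has_field_derivative_def)
  from has_derivative_add[OF DDelta this] show ?thesis
    by (intro that[of c]) (simp add: hamiltonian_def Delta_def case_prod_unfold)
qed

section \<open>The push-forward as a restricted contact Hamiltonian field\<close>

theorem proposition3p2:
  fixes C :: "'n::finite coords set"
    and P :: "(real^'n) set"
    and \<phi> :: "real^'n \<Rightarrow> real"
    and F :: "real^'n \<Rightarrow> real^'n"
    and \<Gamma> :: "real \<Rightarrow> real"
  defines "\<Phi> \<equiv> legendre_embedding \<phi>"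
    and "h \<equiv> hamiltonian \<phi> F \<Gamma>"
  defines "X0 \<equiv> pushforward \<Phi> P F"
  assumes "open C"
    and "open P"
    and "simply_connected P"
    and "\<And>x p z. (x, p, z) \<in> C \<Longrightarrow> p \<in> P"
    and "\<Phi> ` P \<subseteq> C"
    and "smooth_on P \<phi>"
    and "strictly_convex_on P \<phi>"
    and "smooth_on P F"
    and "\<exists>p\<in>P. \<exists>a. F p $ a \<noteq> 0"
    and "smooth_on (Delta0 \<phi> ` C) \<Gamma>"
    and "\<Gamma> 0 = 0"
    and "\<And>s. s \<in> Delta0 \<phi> ` C \<Longrightarrow> s \<noteq> 0 \<Longrightarrow> \<Gamma> s \<noteq> 0"
  shows "(\<forall>p\<in>P. X0 (\<Phi> p) =
            ((\<chi> a. along F (partial a \<phi>) p),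
             F p,
             (\<Sum>j\<in>UNIV. \<Sum>k\<in>UNIV. p $ j * F p $ k * partial k (partial j \<phi>) p))) \<and>
         (\<forall>c t a. c t \<in> P \<longrightarrow> (c has_vector_derivative F (c t)) (at t) \<longrightarrow>
            ((\<lambda>s. partial a \<phi> (c s)) has_real_derivative fst (X0 (\<Phi> (c t))) $ a) (at t)) \<and>
         legendre_image C \<phi> \<subseteq> {\<xi>\<in>C. h \<xi> = 0} \<and>
         (\<forall>\<xi>\<in>legendre_image C \<phi>.
            X0 \<xi> = restrict (contact_ham_field h) {\<xi>\<in>C. h \<xi> = 0} \<xi>)"
proof -
  note openP = assms(5) and CP = assms(7) and \<phi> = assms(9) and F = assms(11)
    and \<Gamma> = assms(13,14)
  have d\<phi>: "\<phi> differentiable (at p)" and d\<phi>': "partial a \<phi> differentiable (at p)"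
    and dF: "F differentiable (at p)" if "p \<in> P" for p a
    using that by (blast intro: smooth_on_differentiable smooth_on_partial \<phi> F)+
  let ?V = "\<lambda>p. ((\<chi> a. \<Sum>k\<in>UNIV. F p $ k * partial k (partial a \<phi>) p), F p,
    (\<Sum>j\<in>UNIV. \<Sum>k\<in>UNIV. p $ j * F p $ k * partial k (partial j \<phi>) p))"
  \<comment> \<open>The base point \<open>p\<close> is itself a component of
    \<open>\<Phi> p\<close>; injectivity lets \<open>inv_into\<close> in the push-forward recover
    it.\<close>
  have "inj_on \<Phi> P"
    by (auto simp: inj_on_def \<Phi>_def legendre_embedding_def)
  then have X0: "X0 (\<Phi> p) = ?V p" if "p \<in> P" for p
    using that
    by (simp add: X0_def pushforward_def \<Phi>_def
        frechet_derivative_at[OF legendre_embedding_has_derivative[OF d\<phi> d\<phi>'], symmetric])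
  \<comment> \<open>Justifies reading \<open>along\<close> as d/dt: the chain rule along a curve
    whose velocity at time \<open>t\<close> is \<open>F (c t)\<close>.\<close>
  have chain: "((\<lambda>s. partial a \<phi> (c s)) has_real_derivative fst (X0 (\<Phi> (c t))) $ a) (at t)"
    if "c t \<in> P" and c: "(c has_vector_derivative F (c t)) (at t)" for c t a
  proof -
    have "((\<lambda>s. partial a \<phi> (c s)) has_derivative
        (\<lambda>s. \<Sum>k\<in>UNIV. (s *\<^sub>R F (c t)) $ k * partial k (partial a \<phi>) (c t))) (at t)"
      using has_derivative_compose[OF c[unfolded has_vector_derivative_def]
          has_derivative_partial_sum[OF d\<phi>'[OF that(1)]]] .
    then show ?thesis
      unfolding has_field_derivative_def
      by (rule has_derivative_eq_rhs)
        (simp add: X0[OF that(1)] fun_eq_iff sum_distrib_left mult_ac)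
  qed
  have h0: "h \<xi> = 0" if "\<xi> \<in> legendre_image C \<phi>" for \<xi>
    using that \<Gamma>(2) by (cases \<xi>) (auto simp: legendre_image_def h_def hamiltonian_def)
  have "X0 \<xi> = contact_ham_field h \<xi>" if \<xi>: "\<xi> \<in> legendre_image C \<phi>" for \<xi>
  proof -
    obtain x p z where \<xi>_eq: "\<xi> = (x, p, z)" by (cases \<xi>)
    have on: "Delta0 \<phi> (x, p, z) = 0" "Delta \<phi> a (x, p, z) = 0" "(x, p, z) \<in> C" for a
      using \<xi> by (auto simp: \<xi>_eq legendre_image_def)
    then have p: "p \<in> P" using CP by blast
    \<comment> \<open>Solving \<Delta>^a = 0 for x^a, and then \<Delta>^0 = 0 for z, gives exactly
      the components of the embedding.\<close>
    have \<xi>\<Phi>: "\<xi> = \<Phi> p"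
      using on by (auto simp: \<xi>_eq \<Phi>_def legendre_embedding_def Delta_def Delta0_def vec_eq_iff
          mult.commute)
    \<comment> \<open>Smoothness of \<open>\<Gamma>\<close> is given only on this image; the point
      at hand shows that the image contains 0.\<close>
    have "0 \<in> Delta0 \<phi> ` C" using on by force
    then have "\<Gamma> differentiable (at 0)" using \<Gamma>(1) by (rule smooth_on_differentiable[rotated])
    from hamiltonian_has_derivative[OF d\<phi>[OF p] d\<phi>'[OF p] dF[OF p] this on(1,2)]
    obtain c where D: "(h has_derivative (\<lambda>(vx, vp, vz).
        (\<Sum>a\<in>UNIV. (vx $ a - (\<Sum>k\<in>UNIV. vp $ k * partial k (partial a \<phi>) p)) * F p $ a)
          + c * ((\<Sum>j\<in>UNIV. vx $ j * p $ j) - vz))) (at (x, p, z))"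
      unfolding h_def .
    have ax: "(\<Sum>a\<in>UNIV. axis b 1 $ a * g a) = g b" for b :: 'n and g :: "'n \<Rightarrow> real"
      by (simp add: axis_def if_distrib[of "\<lambda>y. y * _"] cong: if_cong)
    \<comment> \<open>By \<open>ax\<close>, the differential of \<open>h\<close> on a basis vector
      reduces to a single coefficient. As \<open>h\<close> vanishes here, the z-component is only
      the sum of -p_a \<partial>h/\<partial>p_a; \<open>partial_commute\<close> then brings the
      Hessian indices on both sides into one order.\<close>
    have "contact_ham_field h (x, p, z) = ?V p"
      using h0[OF \<xi>] unfolding contact_ham_field_eq[OF D] \<xi>_eq
      by (simp add: ax sum_negf vec_eq_iff)
        (simp add: sum_distrib_left mult_ac partial_commute[OF openP p \<phi>])
    then show ?thesis using X0[OF p] by (simp add: \<xi>\<Phi>[symmetric] \<xi>_eq)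
  qed
  \<comment> \<open>By \<open>h0\<close> the Legendre image lies in the zero set of
    \<open>h\<close>, where \<open>restrict\<close> returns the field itself and not its default
    value.\<close>
  then show ?thesis
    using X0 chain h0 by (auto simp: along_eq_sum[OF d\<phi>'] legendre_image_def)
qed

end
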